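(* Let $P(X)\in\mathbb Z[X]$ satisfy the standing assumptions in the context, let $k$ be a nonnegative integer, and suppose that $P(X)$ is monic. Then $0$ is an isolated point of the set $\mathcal L^{(k)}(P(X))$ if and only if $P(X)$ is hyperbolic. Moreover, if $P(X)$ is not hyperbolic, then $\mathcal L^{(k)}(P(X))$ is dense in $[0,1/2]$.
   Context: Setting. $P(X)=a_dX^d+\cdots+a_0\in\mathbb Z[X]$ with $d\ge1$, $a_d\ge1$, such that (i) $\gcd(a_d,\dots,a_0)=1$ and $a_0\ne0$; (ii) $P$ has no multiple roots; (iii) every irreducible factor of $P$ in $\mathbb Z[X]$ has at least one root of modulus greater than $1$. The roots of $P$ are $\alpha_1,\dots,\alpha_d$, ordered so that $|\alpha_i|>1$ for $1\le i\le p$ and $|\alpha_i|\le1$ for $p+1\le i\le d$, where $p=r_1+2r_2$, $\alpha_i\in\mathbb R$ for $1\le i\le r_1$, and $\alpha_{r_1+i}\in\mathbb C\setminus\mathbb R$, $\alpha_{r_1+r_2+i}=\overline{\alpha_{r_1+i}}$ for $1\le i\le r_2$. $P$ is called hyperbolic if $|\alpha_i|\ne1$ for every $1\le i\le d$. For an integer $k\ge0$, $\Xi_k$ is the set of $\mathbf g=(g_1,\dots,g_p)\in\mathbb R[X]^{r_1}\times\mathbb C[X]^{2r_2}$ with $\deg g_i\le k$ for all $i$ and $\overline{g_{r_1+i}(X)}=g_{r_1+r_2+i}(X)$ for $1\le i\le r_2$ (the bar conjugates the coefficients). For $\mathbf g\in\Xi_k$ and $n\in\mathbb Z$ put $x_n(\mathbf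 g)=\sum_{i=1}^p g_i(n)\alpha_i^n\in\mathbb R$. $\|x\|$ denotes the distance from $x\in\mathbb R$ to the nearest integer, and $$\mathcal L^{(k)}(P)=\Bigl\{\limsup_{n\to\infty}\|x_n(\mathbf g)\| : \mathbf g\in\Xi_k\Bigr\}\subset[0,1/2].$$ *)

theory Defs
  imports "HOL-Analysis.Analysis" "HOL-Computational_Algebra.Computational_Algebra"
begin

abbreviation cpoly :: "int poly \<Rightarrow> complex poly"
  where "cpoly P \<equiv> map_poly of_int P"

definition hyperbolic :: "int poly \<Rightarrow> bool"
  where "hyperbolic P \<longleftrightarrow> (\<forall>z. poly (cpoly P) z = 0 \<longrightarrow> cmod z \<noteq> 1)"

text \<open>The sequence \<open>\<alpha> 1, \<dots>, \<alpha> d\<close> (with \<open>d = degree P\<close>) lists the complex roots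
  of \<open>P\<close>, each exactly once, which is the list with multiplicity when \<open>P\<close> has no multiple
  roots. Values of \<open>\<alpha>\<close> outside \<open>{1..d}\<close> are irrelevant.\<close>

definition root_ordering :: "int poly \<Rightarrow> nat \<Rightarrow> nat \<Rightarrow> (nat \<Rightarrow> complex) \<Rightarrow> bool"
  where "root_ordering P r1 r2 \<alpha> \<longleftrightarrow>
    bij_betw \<alpha> {1..degree P} {z. poly (cpoly P) z = 0} \<and>
    r1 + 2 * r2 \<le> degree P \<and>
    (\<forall>i\<in>{1..r1 + 2 * r2}. cmod (\<alpha> i) > 1) \<and>
    (\<forall>i\<in>{r1 + 2 * r2 + 1..degree P}. cmod (\<alpha> i) \<le> 1) \<and>
    (\<forall>i\<in>{1..r1}. \<alpha> i \<in> \<real>) \<and>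
    (\<forall>i\<in>{1..r2}. \<alpha> (r1 + i) \<notin> \<real> \<and> \<alpha> (r1 + r2 + i) = cnj (\<alpha> (r1 + i)))"

text \<open>A tuple \<open>(g\<^sub>1, \<dots>, g\<^sub>p)\<close> is represented by a function \<open>g\<close> of which only the values on
  \<open>{1..p}\<close>, \<open>p = r1 + 2 * r2\<close>, are used; real polynomials are complex polynomials with
  real coefficients.\<close>

definition Xi :: "nat \<Rightarrow> nat \<Rightarrow> nat \<Rightarrow> (nat \<Rightarrow> complex poly) set"
  where "Xi k r1 r2 = {g.
    (\<forall>i\<in>{1..r1 + 2 * r2}. degree (g i) \<le> k) \<and>
    (\<forall>i\<in>{1..r1}. \<forall>j. coeff (g i) j \<in> \<real>) \<and>
    (\<forall>i\<in>{1..r2}. map_poly cnj (g (r1 + i)) = g (r1 + r2 + i))}"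

definition x_complex :: "nat \<Rightarrow> (nat \<Rightarrow> complex) \<Rightarrow> (nat \<Rightarrow> complex poly) \<Rightarrow> int \<Rightarrow> complex"
  where "x_complex p \<alpha> g n = (\<Sum>i=1..p. poly (g i) (of_int n) * \<alpha> i powi n)"

text \<open>The sum is real for \<open>g\<close> in \<open>Xi k r1 r2\<close> (see \<open>x_complex_real\<close> below), so that \<open>Re\<close>
  only changes its type.\<close>

definition x_seq :: "nat \<Rightarrow> (nat \<Rightarrow> complex) \<Rightarrow> (nat \<Rightarrow> complex poly) \<Rightarrow> int \<Rightarrow> real"
  where "x_seq p \<alpha> g n = Re (x_complex p \<alpha> g n)"

definition dist_nearest_int :: "real \<Rightarrow> real"
  where "dist_nearest_int x = \<bar>x - of_int (round x)\<bar>"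

definition limsup_spectrum :: "nat \<Rightarrow> nat \<Rightarrow> nat \<Rightarrow> (nat \<Rightarrow> complex) \<Rightarrow> real set"
  where "limsup_spectrum k r1 r2 \<alpha> = {l. \<exists>g\<in>Xi k r1 r2.
    ereal l = limsup (\<lambda>n::nat. ereal (dist_nearest_int (x_seq (r1 + 2 * r2) \<alpha> g (int n))))}"

lemma x_complex_real:
  assumes \<alpha>: "root_ordering P r1 r2 \<alpha>" and g: "g \<in> Xi k r1 r2"
  shows "x_complex (r1 + 2 * r2) \<alpha> g n \<in> \<real>"
proof -
  define t where "t i = poly (g i) (of_int n) * \<alpha> i powi n" for i
  have 1: "t i \<in> \<real>" if "i \<in> {1..r1}" for i
  proof -
    have "poly (g i) (of_int n) \<in> \<real>"
      using g that unfolding Xi_def poly_altdef by (auto intro!: sum_in_Reals Reals_mult Reals_power)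
    moreover have "\<alpha> i powi n \<in> \<real>"
      using \<alpha> that unfolding root_ordering_def power_int_def by (auto intro!: Reals_power)
    ultimately show ?thesis by (auto simp: t_def)
  qed
  have 2: "t (r1 + r2 + i) = cnj (t (r1 + i))" if "i \<in> {1..r2}" for i
  proof -
    have "g (r1 + r2 + i) = map_poly cnj (g (r1 + i))" "\<alpha> (r1 + r2 + i) = cnj (\<alpha> (r1 + i))"
      using g \<alpha> that unfolding Xi_def root_ordering_def by auto
    moreover have "poly (map_poly cnj q) (of_int n) = cnj (poly q (of_int n))" for q
      by (metis complex_cnj_of_int poly_cnj)
    ultimately show ?thesis
      by (simp add: t_def power_int_def)
  qed
  have "{1..r1 + 2 * r2} = {1..r1} \<union> ((+) r1 ` {1..r2} \<union> (+) (r1 + r2) ` {1..r2})"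
    by (auto simp: image_iff Bex_def; presburger)
  hence "(\<Sum>i=1..r1 + 2 * r2. t i) = (\<Sum>i=1..r1. t i) +
      ((\<Sum>i\<in>(+) r1 ` {1..r2}. t i) + (\<Sum>i\<in>(+) (r1 + r2) ` {1..r2}. t i))"
    by (subst sum.union_disjoint[symmetric] | auto)+
  also have "\<dots> = (\<Sum>i=1..r1. t i) + (\<Sum>i=1..r2. t (r1 + i) + cnj (t (r1 + i)))"
    by (simp add: sum.reindex sum.distrib 2 o_def del: image_add_atLeastAtMost)
  also have "\<dots> \<in> \<real>"
    by (rule Reals_add[OF sum_in_Reals sum_in_Reals]) (use 1 in \<open>simp_all add: complex_add_cnj\<close>)
  finally show ?thesis
    by (simp add: x_complex_def t_def)
qed

lemma root_ordering_exists:
  assumes sf: "rsquarefree (cpoly P)"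
  shows "\<exists>r1 r2 \<alpha>. root_ordering P r1 r2 \<alpha>"
proof -
  define Z where "Z = {z. poly (cpoly P) z = 0}"
  have "cpoly P \<noteq> 0" using sf by (simp add: rsquarefree_def)
  hence fin: "finite Z" unfolding Z_def by (rule poly_roots_finite)
  have deg: "card Z = degree P"
  proof -
    define c where "c = lead_coeff (cpoly P)"
    have "smult c (\<Prod>z|poly (cpoly P) z = 0. [:-z, 1:]) = cpoly P"
      using complex_poly_decompose_rsquarefree[OF sf] by (simp add: c_def)
    hence "degree (cpoly P) = degree (smult c (\<Prod>z\<in>Z. [:-z, 1:]))"
      by (simp add: Z_def)
    also have "\<dots> = degree (\<Prod>z\<in>Z. [:-z, 1:])"
      using \<open>cpoly P \<noteq> 0\<close> by (simp add: c_def)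
    also have "\<dots> = card Z"
      by (subst degree_prod_sum_eq) auto
    finally show ?thesis by (simp add: degree_map_poly)
  qed
  have cnjZ: "cnj z \<in> Z" if "z \<in> Z" for z
  proof -
    have "map_poly cnj (cpoly P) = cpoly P" by (intro poly_eqI) (simp add: coeff_map_poly)
    thus ?thesis using that poly_cnj[of "cpoly P" z] unfolding Z_def by (auto simp: poly_cnj)
  qed
  obtain xs where xs: "set xs = {z\<in>Z. cmod z > 1 \<and> z \<in> \<real>}" "distinct xs"
    using finite_distinct_list[of "{z\<in>Z. cmod z > 1 \<and> z \<in> \<real>}"] fin by auto
  obtain us where us: "set us = {z\<in>Z. cmod z > 1 \<and> Im z > 0}" "distinct us"
    using finite_distinct_list[of "{z\<in>Z. cmod z > 1 \<and> Im z > 0}"] fin by auto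
  obtain ss where ss: "set ss = {z\<in>Z. cmod z \<le> 1}" "distinct ss"
    using finite_distinct_list[of "{z\<in>Z. cmod z \<le> 1}"] fin by auto
  define L where "L = xs @ us @ map cnj us @ ss"
  define \<alpha> where "\<alpha> i = L ! (i - 1)" for i
  have "set (map cnj us) = {z\<in>Z. cmod z > 1 \<and> Im z < 0}"
  proof -
    have "z \<in> cnj ` set us" if "z \<in> Z" "cmod z > 1" "Im z < 0" for z
      using that cnjZ[of z] us by (intro image_eqI[of _ _ "cnj z"]) auto
    thus ?thesis using us cnjZ by auto
  qed
  note cs = this
  have setL: "set L = Z"
    unfolding L_def set_append cs xs us ss
    by (auto simp: complex_is_Real_iff)
  have dL: "distinct L"
    unfolding L_def distinct_append set_append cs unfolding xs us ss
    using xs us ss by (auto simp: complex_is_Real_iff distinct_map intro!: inj_onI)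
  have lenL: "length L = degree P"
    using setL dL deg distinct_card by fastforce
  have bij: "bij_betw \<alpha> {1..degree P} Z"
  proof -
    have "bij_betw (\<lambda>i. i - 1) {1..degree P} {..<length L}"
      by (rule bij_betwI[where g = Suc]) (auto simp: lenL)
    from bij_betw_trans[OF this bij_betw_nth[OF dL refl setL[symmetric]]]
    show ?thesis by (simp add: o_def \<alpha>_def[abs_def])
  qed
  have A: "\<alpha> i \<in> set xs" "\<alpha> i = xs ! (i - 1)" if "i \<in> {1..length xs}" for i
    using that by (auto simp: \<alpha>_def L_def nth_append)
  have B: "\<alpha> (length xs + i) = us ! (i - 1)" "\<alpha> (length xs + i) \<in> set us"
    "\<alpha> (length xs + length us + i) = cnj (us ! (i - 1))" if "i \<in> {1..length us}" for i
    using that by (auto simp: \<alpha>_def L_def nth_append)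
  have C: "\<alpha> i \<in> set ss" if "i \<in> {length xs + 2 * length us + 1..degree P}" for i
    using that lenL by (auto simp: \<alpha>_def L_def nth_append intro!: nth_mem)
  have big: "cmod (\<alpha> i) > 1" if "i \<in> {1..length xs + 2 * length us}" for i
  proof -
    consider "i \<le> length xs" | "length xs < i" "i \<le> length xs + length us"
      | "length xs + length us < i"
      by linarith
    thus ?thesis
    proof cases
      case 1
      hence "\<alpha> i \<in> set xs" using A(1)[of i] that by simp
      thus ?thesis using xs(1) by blast
    next
      case 2
      hence "\<alpha> i \<in> set us" using B(2)[of "i - length xs"] by fastforce
      thus ?thesis using us(1) by blast
    next
      case 3
      hence *: "i - length xs - length us \<in> {1..length us}" using that by auto
      have "us ! (i - length xs - length us - 1) \<in> set us"
        using B(1,2)[OF *] by simp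
      moreover have "\<alpha> i = cnj (us ! (i - length xs - length us - 1))"
        using B(3)[OF *] 3 by simp
      ultimately show ?thesis using us(1) by simp
    qed
  qed
  have "root_ordering P (length xs) (length us) \<alpha>"
    unfolding root_ordering_def Z_def[symmetric]
  proof (intro conjI ballI)
    show "length xs + 2 * length us \<le> degree P" using lenL by (simp add: L_def)
  next
    fix i assume "i \<in> {length xs + 2 * length us + 1..degree P}"
    thus "cmod (\<alpha> i) \<le> 1" using C ss(1) by blast
  next
    fix i assume "i \<in> {1..length xs}"
    thus "\<alpha> i \<in> \<real>" using A(1) xs(1) by blast
  next
    fix i assume i: "i \<in> {1..length us}"
    have "Im (\<alpha> (length xs + i)) > 0" using B(2)[OF i] us(1) by blast
    thus "\<alpha> (length xs + i) \<notin> \<real>" by (simp add: complex_is_Real_iff)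
    show "\<alpha> (length xs + length us + i) = cnj (\<alpha> (length xs + i))"
      using B(1,3)[OF i] by simp
  qed (use bij big in blast)+
  thus ?thesis by blast
qed

end

theory Submission
  imports Defs
begin

text \<open>
  Write \<open>x n\<close> for \<open>x_seq p \<alpha> g n\<close>, \<open>s n\<close> for the integer nearest to \<open>x n\<close> and
  \<open>e n = x n - s n\<close>, so that \<open>dist_nearest_int (x n) = \<bar>e n\<bar>\<close>. A polynomial acts on sequences
  by letting the indeterminate act as the shift (\<open>recur_op\<close> below).

  \<^emph>\<open>Hyperbolic case.\<close> The power \<open>Q = P ^ Suc k\<close> annihilates \<open>x\<close>
  (\<open>recur_op_kills_x_complex\<close>), hence \<open>Q\<close> maps \<open>e\<close> to the negative of its image of \<open>s\<close>,
  an integer sequence. If the limsup of \<open>\<bar>e n\<bar>\<close> is below the reciprocal of the sum of the absolute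
  values of the coefficients of \<open>Q\<close>, these integers are eventually less than \<open>1\<close> in absolute value
  and so vanish. Then \<open>e\<close> is bounded and eventually satisfies a linear recurrence without characteristic
  roots on the unit circle, which forces \<open>e\<close> to tend to \<open>0\<close>
  (\<open>tendsto_0_of_roots_off_circle\<close>): no element of the spectrum lies strictly between \<open>0\<close> and
  this bound.

  \<^emph>\<open>Non-hyperbolic case.\<close> If \<open>l\<close> belongs to the spectrum, so does every multiple \<open>N * l\<close> that is
  less than \<open>1/2\<close>, because the tuple \<open>g\<close> may be multiplied by \<open>N\<close>
  (\<open>limsup_spectrum_multiple\<close>). Density in \<open>{0..1/2}\<close>, and with it the failure of isolation, thus
  reduces to finding arbitrarily small positive elements (\<open>small_positive_limsup_exists\<close>).
  Take the constants \<open>g i = \<alpha> i ^ m' - \<alpha> i ^ m\<close>. Extending the sum defining \<open>x n\<close> over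
  all the roots of the monic \<open>P\<close> produces a difference of two power sums of algebraic integers, which is an
  integer (\<open>power_sum_Ints\<close>); hence \<open>- e n\<close> is the sum of
  \<open>(\<alpha> i ^ m' - \<alpha> i ^ m) * \<alpha> i ^ n\<close> over the roots in the closed unit disc. By compactness
  of the disc, \<open>m < m'\<close> can be chosen to make all these coefficients small. At a root on the unit
  circle the coefficient is not \<open>0\<close>, because such a root is not a root of unity: otherwise its
  minimal polynomial, an irreducible factor of \<open>P\<close>, would divide some \<open>X ^ j - 1\<close> and have no root
  outside the disc. A nonzero coefficient on the unit circle prevents \<open>e\<close> from tending to \<open>0\<close>
  (\<open>nonzero_geometric_sum_not_tendsto_0\<close>), so the limsup is positive.
\<close>

section \<open>Polynomials in the shift operator\<close>

definition recur_op :: "complex poly \<Rightarrow> (nat \<Rightarrow> complex) \<Rightarrow> nat \<Rightarrow> complex"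
  where "recur_op A u n = (\<Sum>j\<le>degree A. coeff A j * u (n + j))"

lemma recur_op_bound:
  assumes "degree A \<le> m"
  shows "recur_op A u n = (\<Sum>j\<le>m. coeff A j * u (n + j))"
  unfolding recur_op_def
  by (rule sum.mono_neutral_left) (use assms in \<open>auto simp: coeff_eq_0\<close>)

lemma recur_op_0 [simp]: "recur_op 0 u n = 0"
  by (simp add: recur_op_def)

lemma recur_op_const [simp]: "recur_op [:c:] u n = c * u n"
  by (simp add: recur_op_def)

lemma recur_op_pCons: "recur_op (pCons a A) u n = a * u n + recur_op A u (Suc n)"
proof -
  have "recur_op (pCons a A) u n = (\<Sum>j\<le>Suc (degree A). coeff (pCons a A) j * u (n + j))"
    by (rule recur_op_bound) (simp add: degree_pCons_le)
  also have "\<dots> = a * u n + recur_op A u (Suc n)"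
    by (subst sum.atMost_Suc_shift) (simp add: recur_op_def)
  finally show ?thesis .
qed

lemma recur_op_linear_factor: "recur_op [:-z, 1:] u n = u (Suc n) - z * u n"
  by (simp add: recur_op_pCons)

lemma recur_op_add: "recur_op (A + B) u n = recur_op A u n + recur_op B u n"
proof -
  define m where "m = max (degree A) (degree B)"
  have "degree (A + B) \<le> m" "degree A \<le> m" "degree B \<le> m"
    by (auto simp: m_def degree_add_le)
  thus ?thesis
    by (simp add: recur_op_bound[of _ m] algebra_simps sum.distrib)
qed

lemma recur_op_smult: "recur_op (smult c A) u n = c * recur_op A u n"
  by (simp add: recur_op_bound[of _ "degree A"] degree_smult_le sum_distrib_left mult.assoc)

text \<open>This is what lets a recurrence be handled one characteristic root at a time.\<close>

lemma recur_op_mult: "recur_op (A * B) u n = recur_op A (recur_op B u) n"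
proof (induction A arbitrary: n rule: pCons_induct)
  case (pCons a A)
  show ?case
    by (simp add: recur_op_pCons recur_op_add recur_op_smult pCons.IH)
qed simp

lemma recur_op_sum: "recur_op A (\<lambda>n. \<Sum>i\<in>I. u i n) n = (\<Sum>i\<in>I. recur_op A (u i) n)"
  unfolding recur_op_def sum_distrib_left by (rule sum.swap)

lemma recur_op_diff: "recur_op A (\<lambda>n. u n - v n) n = recur_op A u n - recur_op A v n"
  by (simp add: recur_op_def algebra_simps sum_subtractf)

lemma recur_op_geometric: "recur_op A (\<lambda>n. c * z ^ n) n = poly A z * (c * z ^ n)"
  by (simp add: recur_op_def poly_altdef sum_distrib_left sum_distrib_right power_add mult_ac)

lemma norm_recur_op_le:
  assumes "\<And>m. m \<ge> n \<Longrightarrow> norm (u m) \<le> b"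
  shows "norm (recur_op A u n) \<le> (\<Sum>j\<le>degree A. norm (coeff A j)) * b"
  unfolding recur_op_def sum_distrib_right
  by (rule sum_norm_le) (auto simp: norm_mult intro!: mult_left_mono assms)

lemma recur_op_tendsto_0:
  assumes "u \<longlonglongrightarrow> 0"
  shows "recur_op A u \<longlonglongrightarrow> 0"
proof -
  have "(\<lambda>n. coeff A j * u (n + j)) \<longlonglongrightarrow> 0" for j
    by (intro tendsto_mult_right_zero LIMSEQ_ignore_initial_segment assms)
  hence "(\<lambda>n. \<Sum>j\<le>degree A. coeff A j * u (n + j)) \<longlonglongrightarrow> (\<Sum>j\<le>degree A. 0)"
    by (intro tendsto_sum)
  thus ?thesis by (simp add: recur_op_def[abs_def])
qed

lemma recur_op_Bseq:
  assumes "Bseq u"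
  shows "Bseq (recur_op A u)"
proof -
  obtain b where b: "\<And>n. norm (u n) \<le> b" using assms by (auto simp: Bseq_def)
  show ?thesis by (rule BseqI') (rule norm_recur_op_le[OF b])
qed

section \<open>Bounded solutions without characteristic roots on the unit circle\<close>

text \<open>With \<open>u (Suc n) = z * u n + v n\<close> and \<open>v\<close> tending to \<open>0\<close>, the limsup \<open>r\<close> of \<open>\<bar>u n\<bar>\<close> satisfies
  \<open>r = \<bar>z\<bar> * r\<close>, and boundedness makes \<open>r\<close> finite. Only the inequality that leads to
  \<open>r = 0\<close> is derived in each of the cases \<open>\<bar>z\<bar> < 1\<close> and \<open>\<bar>z\<bar> > 1\<close>.\<close>

lemma tendsto_0_of_linear_factor:
  assumes u: "Bseq u" and lim: "recur_op [:-z, 1:] u \<longlonglongrightarrow> 0" and z: "norm z \<noteq> 1"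
  shows "u \<longlonglongrightarrow> 0"
proof -
  define v where "v = recur_op [:-z, 1:] u"
  have v: "u (Suc n) = z * u n + v n" for n
    by (simp add: v_def recur_op_linear_factor)
  obtain b where b: "\<And>n. norm (u n) \<le> b" using u by (auto simp: Bseq_def)
  have "v \<longlonglongrightarrow> 0" using lim by (simp add: v_def)
  hence v0: "(\<lambda>n. ereal (norm (v n))) \<longlonglongrightarrow> 0"
    by (simp add: zero_ereal_def tendsto_norm_zero)
  define l where "l = limsup (\<lambda>n. ereal (norm (u n)))"
  have "0 \<le> l" unfolding l_def
    by (rule le_Limsup) auto
  moreover have "l \<le> ereal b" unfolding l_def
    by (rule Limsup_bounded) (simp add: b)
  ultimately obtain r where r: "l = ereal r" "r \<ge> 0" by (cases l) auto
  have shift: "limsup (\<lambda>n. ereal (norm (u (Suc n)))) = l"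
    using limsup_shift[of "\<lambda>n. ereal (norm (u n))"] by (simp add: l_def)
  have mult: "limsup (\<lambda>n. ereal (norm (z * u n))) = ereal (norm z) * l"
    using Limsup_ereal_mult_left[of sequentially "norm z" "\<lambda>n. ereal (norm (u n))"]
    by (simp add: norm_mult l_def)
  have "l = 0"
  proof (cases "norm z < 1")
    case True
    have "l \<le> limsup (\<lambda>n. ereal (norm (v n)) + ereal (norm (z * u n)))"
      unfolding shift[symmetric]
      by (rule Limsup_mono) (auto simp: v intro!: always_eventually order_trans[OF norm_triangle_ineq])
    also have "\<dots> = 0 + limsup (\<lambda>n. ereal (norm (z * u n)))"
      by (rule ereal_limsup_lim_add[OF v0]) simp
    finally have "r \<le> norm z * r" by (simp add: mult r)
    thus ?thesis using True r by (simp add: mult_le_cancel_right1)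
  next
    case False
    hence z1: "norm z > 1" using z by simp
    have "ereal (norm z) * l \<le> limsup (\<lambda>n. ereal (norm (v n)) + ereal (norm (u (Suc n))))"
      unfolding mult[symmetric]
    proof (rule Limsup_mono, rule always_eventually, rule allI)
      fix n
      have "norm (z * u n) = norm (u (Suc n) - v n)" by (simp add: v)
      also have "\<dots> \<le> norm (v n) + norm (u (Suc n))"
        by (metis add.commute norm_triangle_ineq4)
      finally show "ereal (norm (z * u n)) \<le> ereal (norm (v n)) + ereal (norm (u (Suc n)))"
        by simp
    qed
    also have "\<dots> = 0 + limsup (\<lambda>n. ereal (norm (u (Suc n))))"
      by (rule ereal_limsup_lim_add[OF v0]) simp
    finally have "norm z * r \<le> r" by (simp add: shift r)
    thus ?thesis using z1 r by (simp add: mult_le_cancel_right2)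
  qed
  show ?thesis
  proof (rule tendstoI)
    fix e :: real assume "e > 0"
    hence "limsup (\<lambda>n. ereal (norm (u n))) < ereal e" using \<open>l = 0\<close> by (simp add: l_def)
    from Limsup_lessD[OF this] show "\<forall>\<^sub>F n in sequentially. dist (u n) 0 < e" by simp
  qed
qed


text \<open>Strip off one linear factor \<open>X - z\<close> at a time: the remaining factor maps \<open>u\<close> to a bounded
  sequence, which the previous lemma shows to tend to \<open>0\<close>.\<close>

lemma tendsto_0_of_roots_off_circle:
  assumes "A \<noteq> 0" and "\<And>z. poly A z = 0 \<Longrightarrow> norm z \<noteq> 1"
    and "Bseq u" and "recur_op A u \<longlonglongrightarrow> 0"
  shows "u \<longlonglongrightarrow> 0"
  using assms
proof (induction "degree A" arbitrary: A)
  case 0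
  then obtain c where A: "A = [:c:]" by (metis degree_eq_zeroE)
  have "recur_op A u = (\<lambda>n. c * u n)" by (simp add: A fun_eq_iff)
  hence "(\<lambda>n. c * u n) \<longlonglongrightarrow> 0" "c \<noteq> 0" using 0 A by auto
  thus ?case
    using tendsto_mult_left_iff[of c u 0] by simp
next
  case (Suc m)
  obtain z where z: "poly A z = 0"
    using fundamental_theorem_of_algebra[of A] Suc.hyps(2) by (auto simp: constant_degree)
  then obtain B where B: "A = [:-z, 1:] * B" by (auto simp: poly_eq_0_iff_dvd)
  have "B \<noteq> 0" using Suc.prems(1) B by auto
  have "degree A = Suc (degree B)"
    unfolding B by (subst degree_mult_eq) (use \<open>B \<noteq> 0\<close> in auto)
  have "recur_op [:-z, 1:] (recur_op B u) \<longlonglongrightarrow> 0"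
    using Suc.prems(4) by (simp only: B recur_op_mult[abs_def])
  hence "recur_op B u \<longlonglongrightarrow> 0"
    using tendsto_0_of_linear_factor recur_op_Bseq Suc.prems(2,3) z by blast
  moreover have "norm w \<noteq> 1" if "poly B w = 0" for w
    using Suc.prems(2)[of w] that by (simp add: B)
  ultimately show ?case
    using Suc.hyps(1)[of B] \<open>B \<noteq> 0\<close> Suc.hyps(2) Suc.prems(3) \<open>degree A = Suc (degree B)\<close> by simp
qed

section \<open>The hyperbolic case\<close>

text \<open>The factor \<open>X - z\<close> turns \<open>g(n) * z ^ n\<close> into \<open>z * (g(n + 1) - g(n)) * z ^ n\<close>, and taking the
  difference lowers the degree of \<open>g\<close>.\<close>

lemma recur_op_kills_poly_geometric:
  assumes "g = 0 \<or> degree g < k"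
  shows "recur_op ([:-z, 1:] ^ k) (\<lambda>n. poly g (of_nat n) * z ^ n) = (\<lambda>n. 0)"
  using assms
proof (induction k arbitrary: g)
  case 0
  thus ?case by (simp add: recur_op_def fun_eq_iff)
next
  case (Suc k)
  define h where "h = smult z (pcompose g [:1, 1:] - g)"
  have step: "recur_op [:-z, 1:] (\<lambda>n. poly g (of_nat n) * z ^ n) = (\<lambda>n. poly h (of_nat n) * z ^ n)"
    by (simp add: fun_eq_iff recur_op_linear_factor h_def poly_pcompose algebra_simps)
  have "degree h \<le> degree g"
    unfolding h_def
    by (intro order_trans[OF degree_smult_le] degree_diff_le) (simp_all add: degree_pcompose)
  moreover have "coeff h (degree g) = 0"
    using lead_coeff_comp[of "[:1, 1:]" g] by (simp add: h_def degree_pcompose)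
  ultimately have "h = 0 \<or> degree h < degree g"
    by (rule eq_zero_or_degree_less)
  moreover have "h = 0" if "g = 0" using that by (simp add: h_def)
  ultimately have "h = 0 \<or> degree h < k" using Suc.prems by auto
  from Suc.IH[OF this] show ?case
    unfolding power_Suc2 by (simp only: fun_eq_iff recur_op_mult step) simp
qed

lemma recur_op_kills_x_complex:
  assumes "root_ordering P r1 r2 \<alpha>" and "g \<in> Xi k r1 r2"
  shows "recur_op (cpoly P ^ Suc k) (\<lambda>n. x_complex (r1 + 2 * r2) \<alpha> g (int n)) n = 0"
proof -
  have "recur_op (cpoly P ^ Suc k) (\<lambda>n. poly (g i) (of_nat n) * \<alpha> i ^ n) n = 0"
    if i: "i \<in> {1..r1 + 2 * r2}" for i
  proof -
    have "poly (cpoly P) (\<alpha> i) = 0"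
      using assms(1) i unfolding root_ordering_def bij_betw_def by fastforce
    then obtain R where R: "cpoly P = [:-\<alpha> i, 1:] * R" by (auto simp: poly_eq_0_iff_dvd)
    have "cpoly P ^ Suc k = R ^ Suc k * [:-\<alpha> i, 1:] ^ Suc k"
      unfolding R power_mult_distrib by (rule mult.commute)
    moreover have "degree (g i) < Suc k"
      using assms(2) i by (auto simp: Xi_def less_Suc_eq_le)
    ultimately show ?thesis
      by (simp only: recur_op_mult recur_op_kills_poly_geometric[OF disjI2]) (simp add: recur_op_def)
  qed
  thus ?thesis
    by (simp add: x_complex_def recur_op_sum)
qed

lemma coeff_power_Ints:
  fixes A :: "complex poly"
  assumes "\<And>j. coeff A j \<in> \<int>"
  shows "coeff (A ^ k) j \<in> \<int>"
proof (induction k arbitrary: j)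
  case (Suc k)
  show ?case unfolding power_Suc coeff_mult by (intro Ints_sum Ints_mult assms Suc.IH)
qed (auto simp: coeff_1)

lemma recur_op_Ints:
  assumes "\<And>j. coeff A j \<in> \<int>" and "\<And>n. u n \<in> \<int>"
  shows "recur_op A u n \<in> \<int>"
  unfolding recur_op_def by (intro Ints_sum Ints_mult assms)

lemma dist_nearest_int_le_half: "dist_nearest_int x \<le> 1 / 2"
  using of_int_round_abs_le[of x] by (simp add: dist_nearest_int_def abs_minus_commute)

lemma dist_nearest_int_nonneg: "0 \<le> dist_nearest_int x"
  by (simp add: dist_nearest_int_def)

lemma dist_nearest_int_eqI:
  assumes "\<bar>x - of_int m\<bar> < 1 / 2"
  shows "dist_nearest_int x = \<bar>x - of_int m\<bar>"
  using round_unique'[OF assms] by (simp add: dist_nearest_int_def)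

text \<open>The sum in the last assumption bounds the norm of the operator \<open>P ^ Suc k\<close> on bounded
  sequences. Below its reciprocal the operator maps the fractional parts to integers of absolute
  value less than \<open>1\<close>.\<close>

lemma hyperbolic_small_limsup_eq_0:
  assumes P: "P \<noteq> 0" "hyperbolic P" and ro: "root_ordering P r1 r2 \<alpha>"
    and l: "l \<in> limsup_spectrum k r1 r2 \<alpha>"
    and small: "l * (\<Sum>j\<le>degree (cpoly P ^ Suc k). norm (coeff (cpoly P ^ Suc k) j)) < 1"
  shows "l = 0"
proof -
  define Q where "Q = cpoly P ^ Suc k"
  define L where "L = (\<Sum>j\<le>degree Q. norm (coeff Q j))"
  obtain g where g: "g \<in> Xi k r1 r2"
    and lg: "ereal l = limsup (\<lambda>n::nat. ereal (dist_nearest_int (x_seq (r1 + 2 * r2) \<alpha> g (int n))))"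
    using l by (auto simp: limsup_spectrum_def)
  define x where "x n = x_seq (r1 + 2 * r2) \<alpha> g (int n)" for n
  define s where "s n = round (x n)" for n
  define e where "e n = complex_of_real (x n) - of_int (s n)" for n
  have norm_e: "norm (e n) = dist_nearest_int (x n)" for n
  proof -
    have "e n = complex_of_real (x n - of_int (s n))" by (simp add: e_def)
    thus ?thesis by (simp only: norm_of_real dist_nearest_int_def s_def)
  qed
  have x_complex: "complex_of_real (x n) = x_complex (r1 + 2 * r2) \<alpha> g (int n)" for n
    using x_complex_real[OF ro g, of "int n"] by (simp add: x_def x_seq_def)
  have "cpoly P \<noteq> 0" using P(1) by (simp add: map_poly_eq_0_iff)
  hence Q0: "Q \<noteq> 0" by (simp add: Q_def)
  have QZ: "coeff Q j \<in> \<int>" for j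
    unfolding Q_def by (rule coeff_power_Ints) (simp add: coeff_map_poly)
  have "recur_op Q e n = - recur_op Q (\<lambda>n. of_int (s n)) n" for n
    unfolding e_def recur_op_diff x_complex
    using recur_op_kills_x_complex[OF ro g, of n] by (simp add: Q_def)
  hence int: "recur_op Q e n \<in> \<int>" for n
    by (auto intro!: recur_op_Ints QZ)
  have "L > 0"
  proof -
    have "norm (coeff Q (degree Q)) \<le> L" unfolding L_def by (rule member_le_sum) auto
    thus ?thesis using Q0 by (smt (verit) leading_coeff_0_iff zero_less_norm_iff)
  qed
  have "l < 1 / L" using small \<open>L > 0\<close> by (simp add: Q_def L_def field_simps)
  then obtain b where b: "l < b" "b < 1 / L" using dense by blast
  have "limsup (\<lambda>n. ereal (norm (e n))) < ereal b"
    using b(1) by (simp add: norm_e x_def flip: lg)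
  from Limsup_lessD[OF this] obtain N where N: "\<And>n. n \<ge> N \<Longrightarrow> norm (e n) < b"
    by (auto simp: eventually_sequentially)
  have zero: "recur_op Q e n = 0" if "n \<ge> N" for n
  proof -
    have "norm (recur_op Q e n) \<le> L * b"
      unfolding L_def by (rule norm_recur_op_le) (use N that in \<open>meson less_imp_le order_trans\<close>)
    also have "\<dots> < 1" using b(2) \<open>L > 0\<close> by (simp add: field_simps)
    finally show ?thesis using int[of n] by (auto elim!: Ints_cases)
  qed
  have "e \<longlonglongrightarrow> 0"
  proof (rule tendsto_0_of_roots_off_circle[OF Q0])
    show "norm z \<noteq> 1" if "poly Q z = 0" for z
      using that P(2) by (auto simp: Q_def poly_power hyperbolic_def)
    show "Bseq e" by (rule BseqI'[of _ "1/2"]) (simp only: norm_e dist_nearest_int_le_half)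
    show "recur_op Q e \<longlonglongrightarrow> 0"
      by (rule tendsto_eventually) (use zero in \<open>auto simp: eventually_sequentially\<close>)
  qed
  hence "(\<lambda>n. ereal (norm (e n))) \<longlonglongrightarrow> 0" by (simp add: zero_ereal_def tendsto_norm_zero)
  from lim_imp_Limsup[OF _ this] show ?thesis
    using lg by (simp add: norm_e x_def)
qed

section \<open>Roots on the unit circle are not roots of unity\<close>

lemma poly_cpoly_pCons: "poly (cpoly (pCons a A)) z = of_int a + z * poly (cpoly A) z"
  by (simp add: map_poly_pCons)

lemma poly_cpoly_add: "poly (cpoly (A + B)) z = poly (cpoly A) z + poly (cpoly B) z"
proof -
  have "cpoly (A + B) = cpoly A + cpoly B" by (rule poly_eqI) (simp add: coeff_map_poly)
  thus ?thesis by simp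
qed

lemma poly_cpoly_smult: "poly (cpoly (smult c A)) z = of_int c * poly (cpoly A) z"
proof -
  have "cpoly (smult c A) = smult (of_int c) (cpoly A)" by (rule poly_eqI) (simp add: coeff_map_poly)
  thus ?thesis by simp
qed

lemma poly_cpoly_mult: "poly (cpoly (A * B)) z = poly (cpoly A) z * poly (cpoly B) z"
  by (induction A rule: pCons_induct)
    (simp_all add: poly_cpoly_add poly_cpoly_smult poly_cpoly_pCons algebra_simps)

text \<open>The minimal polynomial of \<open>z\<close> over the integers is the primitive part of a nonzero integer
  polynomial of least degree vanishing at \<open>z\<close>. Pseudo-division by it leaves no remainder, so it
  divides a constant multiple of any \<open>F\<close> vanishing at \<open>z\<close>; being a prime element of positive
  degree, it then divides \<open>F\<close> itself. This avoids passing to rational coefficients and back.\<close>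

lemma minimal_int_poly_exists:
  fixes P :: "int poly"
  assumes "P \<noteq> 0" and "poly (cpoly P) z = 0"
  obtains M :: "int poly" where "irreducible M" "\<And>F. poly (cpoly F) z = 0 \<Longrightarrow> M dvd F"
proof -
  define S where "S F \<longleftrightarrow> F \<noteq> 0 \<and> poly (cpoly F) z = 0" for F
  obtain F0 where F0: "S F0" "\<And>F. S F \<Longrightarrow> degree F0 \<le> degree F"
    using ex_has_least_nat[of S P degree] assms by (auto simp: S_def)
  define M where "M = primitive_part F0"
  have F0_eq: "F0 = smult (content F0) M" by (simp add: M_def)
  have M0: "M \<noteq> 0" using F0(1) by (auto simp: S_def M_def)
  have Mz: "poly (cpoly M) z = 0"
    using F0(1) poly_cpoly_smult[of "content F0" M z] by (simp add: S_def F0_eq[symmetric])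
  have cM: "content M = 1" using F0(1) by (simp add: M_def S_def)
  have min: "degree M \<le> degree F" if "S F" for F
    using F0(2)[OF that] by (simp add: M_def)
  have degM: "degree M \<noteq> 0"
  proof
    assume "degree M = 0"
    then obtain c where "M = [:c:]" by (metis degree_eq_zeroE)
    thus False using Mz M0 by (simp add: map_poly_pCons)
  qed
  have unit: "B dvd 1" if "M = A * B" "poly (cpoly A) z = 0" for A B
  proof -
    have nz: "A \<noteq> 0" "B \<noteq> 0" using M0 that(1) by auto
    hence "degree M \<le> degree A" using min that(2) by (simp add: S_def)
    hence "degree B = 0" using nz by (simp add: that(1) degree_mult_eq)
    then obtain c where c: "B = [:c:]" by (metis degree_eq_zeroE)
    hence "[:c:] dvd M" using that(1) by (metis dvd_triv_right)
    hence "c dvd content M" by (simp add: const_poly_dvd_iff_dvd_content)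
    thus ?thesis using cM c by (simp add: is_unit_const_poly_iff)
  qed
  have irr: "irreducible M"
  proof (rule irreducibleI)
    show "\<not> M dvd 1" using degM by (auto simp: is_unit_poly_iff)
    fix A B assume AB: "M = A * B"
    hence "poly (cpoly A) z = 0 \<or> poly (cpoly B) z = 0"
      using Mz by (simp add: poly_cpoly_mult)
    thus "A dvd 1 \<or> B dvd 1"
      using unit[of A B] unit[of B A] AB by (auto simp: mult.commute)
  qed (rule M0)
  have "M dvd F" if F: "poly (cpoly F) z = 0" for F
  proof -
    define r where "r = pseudo_mod F M"
    obtain a q where aq: "a \<noteq> 0" "smult a F = M * q + r" and r: "r = 0 \<or> degree r < degree M"
      using pseudo_mod[OF M0, of F] by (auto simp: r_def)
    have "poly (cpoly (smult a F)) z = poly (cpoly r) z"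
      unfolding aq(2) by (simp add: poly_cpoly_add poly_cpoly_mult Mz)
    hence "poly (cpoly r) z = 0" using F by (simp add: poly_cpoly_smult)
    hence "r = 0" using r min[of r] unfolding S_def by linarith
    hence "M dvd [:a:] * F" using aq(2) by simp
    moreover have "prime_elem M"
      using irr by (rule irreducible_imp_prime_elem_gcd)
    moreover have "\<not> M dvd [:a:]"
      using aq(1) degM dvd_imp_degree_le[of M "[:a:]"] by auto
    ultimately show ?thesis using prime_elem_dvd_multD by blast
  qed
  with irr show ?thesis by (rule that)
qed

lemma integer_poly_root_not_root_of_unity:
  assumes "P \<noteq> 0" and "poly (cpoly P) z = 0"
    and big: "\<And>Q. irreducible Q \<Longrightarrow> Q dvd P \<Longrightarrow> \<exists>z. poly (cpoly Q) z = 0 \<and> cmod z > 1"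
    and "m > 0"
  shows "z ^ m \<noteq> 1"
proof
  assume zm: "z ^ m = 1"
  obtain M where M: "irreducible M" "\<And>F. poly (cpoly F) z = 0 \<Longrightarrow> M dvd F"
    using minimal_int_poly_exists[OF assms(1,2)] by blast
  have ev: "poly (cpoly (monom 1 m + [:-1:])) w = w ^ m - 1" for w
    by (simp add: poly_cpoly_add map_poly_monom poly_monom map_poly_pCons)
  have "M dvd P" by (rule M(2)) fact
  then obtain w where w: "poly (cpoly M) w = 0" "cmod w > 1" using big[OF M(1)] by blast
  have "M dvd monom 1 m + [:-1:]" by (rule M(2)) (simp add: ev zm)
  then obtain R where "monom 1 m + [:-1:] = M * R" by (elim dvdE)
  hence "w ^ m - 1 = poly (cpoly M) w * poly (cpoly R) w"
    by (metis ev poly_cpoly_mult)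
  hence "cmod w ^ m = 1" using w(1) by (simp flip: norm_power)
  thus False using w(2) \<open>m > 0\<close> by (metis one_less_power less_irrefl)
qed

section \<open>Power sums of algebraic integers\<close>

text \<open>This is a form of Newton's identities. With \<open>A\<close> the product of all \<open>X - \<alpha> i\<close> and \<open>S i\<close> the
  cofactor of \<open>X - \<alpha> i\<close>, let \<open>q n k\<close> be the sum of \<open>\<alpha> i ^ n * coeff (S i) k\<close> over \<open>i\<close>. Comparing
  coefficients in \<open>A = (X - \<alpha> i) * S i\<close> expresses these sums for \<open>Suc n\<close> through those for \<open>n\<close>
  and the coefficients of \<open>A\<close>. For \<open>n = 0\<close> they are the coefficients of the derivative of \<open>A\<close>, so all of them are integers;
  the power sums occur as those with the leading index, \<open>S i\<close> being monic.\<close>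

lemma power_sum_Ints:
  fixes \<alpha> :: "'i \<Rightarrow> complex"
  assumes "finite I" and coeffs: "\<And>j. coeff (\<Prod>i\<in>I. [:-\<alpha> i, 1:]) j \<in> \<int>"
  shows "(\<Sum>i\<in>I. \<alpha> i ^ n) \<in> \<int>"
proof (cases "I = {}")
  case False
  define A where "A = (\<Prod>i\<in>I. [:-\<alpha> i, 1:])"
  define S where "S i = (\<Prod>j\<in>I - {i}. [:-\<alpha> j, 1:])" for i
  define q where "q n k = (\<Sum>i\<in>I. \<alpha> i ^ n * coeff (S i) k)" for n k
  define d where "d = card I - 1"
  have AZ: "coeff A j \<in> \<int>" for j using coeffs by (simp add: A_def)
  have fac: "A = [:-\<alpha> i, 1:] * S i" if "i \<in> I" for i
    unfolding A_def S_def using assms(1) that by (simp add: prod.remove)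
  have degS: "degree (S i) = d" if "i \<in> I" for i
    unfolding S_def d_def using assms(1) that by (subst degree_prod_sum_eq) auto
  have top: "coeff (S i) d = 1" if "i \<in> I" for i
    using lead_coeff_prod[of "\<lambda>j. [:-\<alpha> j, 1:]" "I - {i}"] degS[OF that] by (simp add: S_def)
  have pow: "(\<Sum>i\<in>I. \<alpha> i ^ n) = q n d" for n
    by (simp add: q_def top)
  have step: "q (Suc n) (Suc k) = q n k - q n d * coeff A (Suc k)" for n k
  proof -
    have "\<alpha> i * coeff (S i) (Suc k) = coeff (S i) k - coeff A (Suc k)" if "i \<in> I" for i
      by (simp add: fac[OF that])
    hence "q (Suc n) (Suc k) = (\<Sum>i\<in>I. \<alpha> i ^ n * (coeff (S i) k - coeff A (Suc k)))"
      unfolding q_def by (intro sum.cong) (simp_all add: mult.assoc mult.left_commute)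
    thus ?thesis
      unfolding pow[of n, symmetric] by (simp add: q_def algebra_simps sum_subtractf sum_distrib_left)
  qed
  have step0: "q (Suc n) 0 = - q n d * coeff A 0" for n
  proof -
    have "\<alpha> i * coeff (S i) 0 = - coeff A 0" if "i \<in> I" for i
      by (simp add: fac[OF that])
    hence "q (Suc n) 0 = (\<Sum>i\<in>I. \<alpha> i ^ n * (- coeff A 0))"
      unfolding q_def by (intro sum.cong) (simp_all only: power_Suc2 mult.assoc)
    thus ?thesis
      by (simp add: pow[symmetric] sum_negf sum_distrib_left mult.commute)
  qed
  have base: "q 0 k = of_nat (Suc k) * coeff A (Suc k)" for k
  proof -
    have "pderiv A = (\<Sum>i\<in>I. S i)"
      by (simp add: A_def S_def pderiv_prod pderiv_pCons)
    hence "q 0 k = coeff (pderiv A) k" by (simp add: q_def coeff_sum)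
    thus ?thesis by (simp add: coeff_pderiv)
  qed
  have "\<forall>k. q n k \<in> \<int>" for n
  proof (induction n)
    case 0
    show ?case unfolding base by (intro allI Ints_mult AZ Ints_of_nat)
  next
    case (Suc n)
    show ?case
    proof
      fix k
      show "q (Suc n) k \<in> \<int>"
        using Suc.IH AZ by (cases k) (auto simp: step step0 intro!: Ints_mult Ints_diff)
    qed
  qed
  thus ?thesis by (simp add: pow)
qed simp

section \<open>Small positive elements in the non-hyperbolic case\<close>

lemma convergent_powers_subseq:
  fixes \<beta> :: "'i \<Rightarrow> complex"
  assumes "finite I" and "\<And>i. i \<in> I \<Longrightarrow> norm (\<beta> i) \<le> 1"
  shows "\<exists>r::nat \<Rightarrow> nat. strict_mono r \<and> (\<forall>i\<in>I. convergent (\<lambda>n. \<beta> i ^ r n))"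
  using assms
proof (induction I rule: finite_induct)
  case empty
  show ?case by (rule exI[of _ id]) (simp add: strict_mono_def)
next
  case (insert i I)
  then obtain r where r: "strict_mono r" "\<And>j. j \<in> I \<Longrightarrow> convergent (\<lambda>n. \<beta> j ^ r n)"
    by auto
  have "bounded (range (\<lambda>n. \<beta> i ^ r n))"
    by (rule boundedI[of _ 1]) (use insert.prems in \<open>auto simp: norm_power power_le_one\<close>)
  then obtain l r' where r': "strict_mono r'" "((\<lambda>n. \<beta> i ^ r n) \<circ> r') \<longlonglongrightarrow> l"
    using bounded_imp_convergent_subsequence by blast
  have "convergent (\<lambda>n. \<beta> j ^ (r \<circ> r') n)" if "j \<in> insert i I" for j
  proof (cases "j = i")
    case True
    thus ?thesis using r'(2) by (auto simp: convergent_def o_def)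
  next
    case False
    hence "convergent ((\<lambda>n. \<beta> j ^ r n) \<circ> r')"
      using that r(2) r'(1) by (intro convergent_subseq_convergent) auto
    thus ?thesis by (simp add: o_def)
  qed
  thus ?case using strict_mono_o[OF r(1) r'(1)] by blast
qed

text \<open>Consecutive terms of a convergent subsequence of the powers are eventually close, for finitely
  many bases at once.\<close>

lemma close_powers_exist:
  fixes \<beta> :: "'i \<Rightarrow> complex"
  assumes "finite I" and "\<And>i. i \<in> I \<Longrightarrow> norm (\<beta> i) \<le> 1" and "\<delta> > 0"
  obtains m m' :: nat where "m < m'" "\<And>i. i \<in> I \<Longrightarrow> norm (\<beta> i ^ m' - \<beta> i ^ m) < \<delta>"
proof -
  obtain r where r: "strict_mono r" "\<And>i. i \<in> I \<Longrightarrow> convergent (\<lambda>n. \<beta> i ^ r n)"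
    using convergent_powers_subseq[of I \<beta>] assms(1,2) by blast
  have "\<forall>\<^sub>F n in sequentially. norm (\<beta> i ^ r (Suc n) - \<beta> i ^ r n) < \<delta>" if i: "i \<in> I" for i
  proof -
    obtain l where l: "(\<lambda>n. \<beta> i ^ r n) \<longlonglongrightarrow> l" using r(2)[OF i] by (auto simp: convergent_def)
    have "(\<lambda>n. \<beta> i ^ r (Suc n) - \<beta> i ^ r n) \<longlonglongrightarrow> l - l"
      by (intro tendsto_diff l LIMSEQ_Suc)
    from tendstoD[OF this assms(3)] show ?thesis by (simp add: dist_norm)
  qed
  hence "\<forall>\<^sub>F n in sequentially. \<forall>i\<in>I. norm (\<beta> i ^ r (Suc n) - \<beta> i ^ r n) < \<delta>"
    using assms(1) by (simp add: eventually_ball_finite_distrib)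
  then obtain n where "\<forall>i\<in>I. norm (\<beta> i ^ r (Suc n) - \<beta> i ^ r n) < \<delta>"
    by (auto simp: eventually_sequentially)
  thus ?thesis using that[of "r n" "r (Suc n)"] r(1) by (auto simp: strict_mono_def)
qed

lemma limsup_dist_nearest_int_real:
  obtains l where "ereal l = limsup (\<lambda>n::nat. ereal (dist_nearest_int (x n)))" "0 \<le> l" "l \<le> 1 / 2"
proof -
  define L where "L = limsup (\<lambda>n::nat. ereal (dist_nearest_int (x n)))"
  have "0 \<le> L" unfolding L_def by (rule le_Limsup) (auto simp: dist_nearest_int_nonneg)
  moreover have "L \<le> ereal (1 / 2)" unfolding L_def
    by (rule Limsup_bounded) (intro always_eventually allI ereal_less_eq(3)[THEN iffD2] dist_nearest_int_le_half)
  ultimately show ?thesis using that unfolding L_def[symmetric] by (cases L) auto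
qed

lemma limsup_spectrum_subset: "limsup_spectrum k r1 r2 \<alpha> \<subseteq> {0..1/2}"
proof
  fix l assume "l \<in> limsup_spectrum k r1 r2 \<alpha>"
  then obtain g where g: "ereal l = limsup (\<lambda>n::nat. ereal (dist_nearest_int (x_seq (r1 + 2 * r2) \<alpha> g (int n))))"
    by (auto simp: limsup_spectrum_def)
  obtain l' where "ereal l' = limsup (\<lambda>n::nat. ereal (dist_nearest_int (x_seq (r1 + 2 * r2) \<alpha> g (int n))))"
    "0 \<le> l'" "l' \<le> 1 / 2" by (rule limsup_dist_nearest_int_real)
  thus "l \<in> {0..1/2}" using g by (metis atLeastAtMost_iff ereal.inject)
qed

text \<open>The polynomial with roots \<open>\<beta> j\<close> for \<open>j \<noteq> i\<close> isolates the \<open>i\<close>-th term, up to a nonzero factor;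
  that term has constant modulus.\<close>

lemma nonzero_geometric_sum_not_tendsto_0:
  fixes c \<beta> :: "'i \<Rightarrow> complex"
  assumes "finite I" "inj_on \<beta> I" "i \<in> I" "norm (\<beta> i) = 1" "c i \<noteq> 0"
  shows "\<not> (\<lambda>n. \<Sum>j\<in>I. c j * \<beta> j ^ n) \<longlonglongrightarrow> 0"
proof
  assume lim: "(\<lambda>n. \<Sum>j\<in>I. c j * \<beta> j ^ n) \<longlonglongrightarrow> 0"
  define R where "R = (\<Prod>j\<in>I - {i}. [:-\<beta> j, 1:])"
  have Ri: "poly R (\<beta> i) \<noteq> 0"
    using assms(1,2,3) by (auto simp: R_def poly_prod inj_on_def)
  have Rj: "poly R (\<beta> j) = 0" if "j \<in> I - {i}" for j
    using assms(1) that by (auto simp: R_def poly_prod)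
  have "recur_op R (\<lambda>n. \<Sum>j\<in>I. c j * \<beta> j ^ n) n = poly R (\<beta> i) * (c i * \<beta> i ^ n)" for n
  proof -
    have "recur_op R (\<lambda>n. \<Sum>j\<in>I. c j * \<beta> j ^ n) n = (\<Sum>j\<in>I. poly R (\<beta> j) * (c j * \<beta> j ^ n))"
      by (simp add: recur_op_sum recur_op_geometric)
    also have "\<dots> = poly R (\<beta> i) * (c i * \<beta> i ^ n)"
      using assms(1,3) Rj by (simp add: sum.remove)
    finally show ?thesis .
  qed
  hence "recur_op R (\<lambda>n. \<Sum>j\<in>I. c j * \<beta> j ^ n) = (\<lambda>n. poly R (\<beta> i) * (c i * \<beta> i ^ n))"
    by (rule ext)
  with recur_op_tendsto_0[OF lim, of R]
  have "(\<lambda>n. poly R (\<beta> i) * (c i * \<beta> i ^ n)) \<longlonglongrightarrow> 0" by simp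
  hence "(\<lambda>n. norm (poly R (\<beta> i) * (c i * \<beta> i ^ n))) \<longlonglongrightarrow> 0" by (rule tendsto_norm_zero)
  hence "(\<lambda>n::nat. norm (poly R (\<beta> i)) * norm (c i)) \<longlonglongrightarrow> 0"
    by (simp add: norm_mult norm_power assms(4))
  hence "norm (poly R (\<beta> i)) * norm (c i) = 0" by (simp add: LIMSEQ_const_iff)
  thus False using Ri assms(5) by simp
qed

lemma monic_cpoly_eq_prod_roots:
  assumes "rsquarefree (cpoly P)" "lead_coeff P = 1" "root_ordering P r1 r2 \<alpha>"
  shows "cpoly P = (\<Prod>i\<in>{1..degree P}. [:-\<alpha> i, 1:])"
proof -
  have bij: "bij_betw \<alpha> {1..degree P} {z. poly (cpoly P) z = 0}"
    using assms(3) by (simp add: root_ordering_def)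
  have "lead_coeff (cpoly P) = 1" using assms(2) by (simp add: degree_map_poly coeff_map_poly)
  hence "cpoly P = (\<Prod>z|poly (cpoly P) z = 0. [:-z, 1:])"
    using complex_poly_decompose_rsquarefree[OF assms(1)] by simp
  also have "\<dots> = (\<Prod>i\<in>{1..degree P}. [:-\<alpha> i, 1:])"
    using prod.reindex_bij_betw[OF bij] by (rule sym)
  finally show ?thesis .
qed

lemma power_difference_in_Xi:
  assumes "root_ordering P r1 r2 \<alpha>"
  shows "(\<lambda>i. [:\<alpha> i ^ m' - \<alpha> i ^ m:]) \<in> Xi k r1 r2"
  using assms unfolding Xi_def root_ordering_def
  by (auto simp: coeff_pCons map_poly_pCons split: nat.splits intro!: Reals_diff Reals_power)

text \<open>In the proof, \<open>I\<close> indexes the roots in the closed unit disc, \<open>e n\<close> is the sum over these and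
  \<open>x n\<close> the sum over the other roots, so that \<open>x n + e n\<close> is an integer by \<open>power_sum_Ints\<close>.\<close>

lemma small_positive_limsup_exists:
  assumes P: "P \<noteq> 0" "rsquarefree (cpoly P)" "lead_coeff P = 1"
    and big: "\<And>Q. irreducible Q \<Longrightarrow> Q dvd P \<Longrightarrow> \<exists>z. poly (cpoly Q) z = 0 \<and> cmod z > 1"
    and ro: "root_ordering P r1 r2 \<alpha>"
    and nonhyp: "\<not> hyperbolic P" and "\<delta> > 0"
  shows "\<exists>l\<in>limsup_spectrum k r1 r2 \<alpha>. 0 < l \<and> l < \<delta>"
proof -
  define p where "p = r1 + 2 * r2"
  define I where "I = {p + 1..degree P}"
  \<comment> \<open>Below \<open>1/2\<close>, so that \<open>x n + e n\<close> is the integer nearest to \<open>x n\<close>; below \<open>\<delta>\<close>, so that a bound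
     \<open>\<le> \<delta>'\<close> on the terms leaves the limsup strictly below \<open>\<delta>\<close>.\<close>
  define \<delta>' where "\<delta>' = min (\<delta> / 2) (1 / 4)"
  have "\<delta>' > 0" using \<open>\<delta> > 0\<close> by (simp add: \<delta>'_def)
  have bij: "bij_betw \<alpha> {1..degree P} {z. poly (cpoly P) z = 0}" and "p \<le> degree P"
    and small: "\<And>i. i \<in> I \<Longrightarrow> cmod (\<alpha> i) \<le> 1" and large: "\<And>i. i \<in> {1..p} \<Longrightarrow> cmod (\<alpha> i) > 1"
    using ro by (auto simp: root_ordering_def p_def I_def)
  \<comment> \<open>The summand \<open>1\<close> only guards against an empty \<open>I\<close>.\<close>
  have "\<delta>' / (real (card I) + 1) > 0" using \<open>\<delta>' > 0\<close> by simp
  then obtain m m' where "m < m'"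
    and close: "\<And>i. i \<in> I \<Longrightarrow> norm (\<alpha> i ^ m' - \<alpha> i ^ m) < \<delta>' / (real (card I) + 1)"
    by (rule close_powers_exist[of I \<alpha>, rotated 2]) (use small in \<open>simp_all add: I_def\<close>)
  define c where "c i = \<alpha> i ^ m' - \<alpha> i ^ m" for i
  define g where "g i = [:c i:]" for i
  define e where "e n = (\<Sum>i\<in>I. c i * \<alpha> i ^ n)" for n
  define x where "x n = x_seq p \<alpha> g (int n)" for n
  have g: "g \<in> Xi k r1 r2"
    unfolding g_def[abs_def] c_def by (rule power_difference_in_Xi[OF ro])
  have norm_e: "norm (e n) \<le> \<delta>'" for n
  proof -
    have "norm (e n) \<le> (\<Sum>i\<in>I. \<delta>' / (real (card I) + 1))"
      unfolding e_def
    proof (rule sum_norm_le)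
      fix i assume i: "i \<in> I"
      have "norm (c i * \<alpha> i ^ n) \<le> norm (c i) * 1"
        unfolding norm_mult norm_power using small[OF i]
        by (intro mult_left_mono power_le_one) auto
      thus "norm (c i * \<alpha> i ^ n) \<le> \<delta>' / (real (card I) + 1)" using close[OF i] by (simp add: c_def)
    qed
    also have "\<dots> \<le> \<delta>'" using \<open>\<delta>' > 0\<close> by (simp add: field_simps)
    finally show ?thesis .
  qed
  have all_int: "(\<Sum>i=1..degree P. c i * \<alpha> i ^ n) \<in> \<int>" for n
  proof -
    have "(\<Sum>i=1..degree P. \<alpha> i ^ j) \<in> \<int>" for j
      by (rule power_sum_Ints)
        (simp_all only: monic_cpoly_eq_prod_roots[OF P(2,3) ro, symmetric] coeff_map_poly
          finite_atLeastAtMost of_int_0 Ints_of_int)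
    from Ints_diff[OF this[of "m' + n"] this[of "m + n"]] show ?thesis
      by (simp add: c_def algebra_simps power_add sum_subtractf)
  qed
  have dist: "dist_nearest_int (x n) = norm (e n)" for n
  proof -
    obtain s where s: "(\<Sum>i=1..degree P. c i * \<alpha> i ^ n) = of_int s"
      using all_int Ints_cases by metis
    have "{1..degree P} = {1..p} \<union> I" "{1..p} \<inter> I = {}"
      using \<open>p \<le> degree P\<close> by (auto simp: I_def)
    hence "of_int s = (\<Sum>i=1..p. c i * \<alpha> i ^ n) + e n"
      unfolding s[symmetric] e_def by (simp add: sum.union_disjoint I_def)
    also have "(\<Sum>i=1..p. c i * \<alpha> i ^ n) = x_complex p \<alpha> g (int n)"
      by (simp add: x_complex_def g_def)
    also have "\<dots> = complex_of_real (x n)"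
      using x_complex_real[OF ro g, of "int n"] by (simp add: x_def x_seq_def p_def)
    finally have "complex_of_real (x n - of_int s) = - e n" by simp
    hence "\<bar>x n - of_int s\<bar> = norm (e n)" by (metis norm_minus_cancel norm_of_real)
    moreover have "norm (e n) < 1 / 2" using norm_e[of n] by (simp add: \<delta>'_def)
    ultimately show ?thesis using dist_nearest_int_eqI[of "x n" s] by simp
  qed
  obtain l where l: "ereal l = limsup (\<lambda>n. ereal (dist_nearest_int (x n)))" "0 \<le> l"
    using limsup_dist_nearest_int_real[of x] by blast
  have "l \<in> limsup_spectrum k r1 r2 \<alpha>"
    using g l(1) by (auto simp: limsup_spectrum_def x_def p_def)
  moreover have "l \<noteq> 0"
  proof
    assume "l = 0"
    have "e \<longlonglongrightarrow> 0"
    proof (rule tendstoI)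
      fix \<epsilon> :: real assume "\<epsilon> > 0"
      hence "limsup (\<lambda>n. ereal (norm (e n))) < ereal \<epsilon>" using \<open>l = 0\<close> by (simp flip: l(1) dist)
      from Limsup_lessD[OF this] show "\<forall>\<^sub>F n in sequentially. dist (e n) 0 < \<epsilon>" by simp
    qed
    obtain z where z: "poly (cpoly P) z = 0" "cmod z = 1"
      using nonhyp by (auto simp: hyperbolic_def)
    from z(1) have "z \<in> \<alpha> ` {1..degree P}" using bij by (simp add: bij_betw_def)
    then obtain i where i: "i \<in> {1..degree P}" "\<alpha> i = z" by blast
    have "i \<in> I" using large[of i] i z(2) by (cases "i \<le> p") (auto simp: I_def)
    moreover have "c i \<noteq> 0"
    proof
      assume "c i = 0"
      hence "z ^ m * z ^ (m' - m) = z ^ m * 1"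
        using \<open>m < m'\<close> i(2) by (simp add: c_def flip: power_add)
      hence "z ^ (m' - m) = 1" using z(2) by (subst (asm) mult_left_cancel) auto
      thus False
        using integer_poly_root_not_root_of_unity[OF P(1) z(1) big] \<open>m < m'\<close> by simp
    qed
    moreover have "inj_on \<alpha> I"
      using bij by (rule inj_on_subset[OF bij_betw_imp_inj_on]) (auto simp: I_def)
    ultimately show False
      using nonzero_geometric_sum_not_tendsto_0[of I \<alpha> i c] \<open>e \<longlonglongrightarrow> 0\<close> i(2) z(2)
      by (simp add: e_def[abs_def] I_def)
  qed
  moreover have "l < \<delta>"
  proof -
    have "ereal l \<le> ereal \<delta>'" unfolding l(1) by (rule Limsup_bounded) (simp add: dist norm_e)
    thus ?thesis using \<open>\<delta> > 0\<close> by (simp add: \<delta>'_def min_def split: if_splits)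
  qed
  ultimately show ?thesis using l(2) by (intro bexI[of _ l]) linarith+
qed

section \<open>Multiples and density\<close>

text \<open>As long as \<open>N * dist_nearest_int (x n) < 1/2\<close>, the integer nearest to \<open>N * x n\<close> is \<open>N\<close> times the
  one nearest to \<open>x n\<close>. Since \<open>N * l < 1/2\<close> strictly, this holds for all large \<open>n\<close>.\<close>

lemma limsup_spectrum_multiple:
  assumes l: "l \<in> limsup_spectrum k r1 r2 \<alpha>" and "real N * l < 1 / 2"
  shows "real N * l \<in> limsup_spectrum k r1 r2 \<alpha>"
proof -
  obtain g where g: "g \<in> Xi k r1 r2"
    and lg: "ereal l = limsup (\<lambda>n::nat. ereal (dist_nearest_int (x_seq (r1 + 2 * r2) \<alpha> g (int n))))"
    using l by (auto simp: limsup_spectrum_def)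
  define x where "x n = x_seq (r1 + 2 * r2) \<alpha> g (int n)" for n
  define h where "h i = smult (of_nat N) (g i)" for i
  have "map_poly cnj (smult (of_nat N) q) = smult (of_nat N) (map_poly cnj q)" for q
    by (rule poly_eqI) (simp add: coeff_map_poly)
  hence h: "h \<in> Xi k r1 r2"
    using g by (auto simp: Xi_def h_def intro: order_trans[OF degree_smult_le])
  have xh: "x_seq (r1 + 2 * r2) \<alpha> h (int n) = real N * x n" for n
    by (simp add: x_seq_def x_complex_def h_def x_def mult.assoc flip: sum_distrib_left)
  obtain b where b: "l < b" "real N * b < 1 / 2"
  proof (cases "N = 0")
    case True
    thus ?thesis using that[of "l + 1"] by simp
  next
    case False
    hence "l < 1 / (2 * real N)" using assms(2) by (simp add: field_simps)
    then obtain b where "l < b" "b < 1 / (2 * real N)" using dense by blast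
    thus ?thesis using that[of b] False by (simp add: field_simps)
  qed
  have "limsup (\<lambda>n. ereal (dist_nearest_int (x n))) < ereal b"
    using b(1) by (simp add: x_def flip: lg)
  from Limsup_lessD[OF this]
  have ev: "\<forall>\<^sub>F n in sequentially. ereal (dist_nearest_int (real N * x n)) = ereal (real N) * ereal (dist_nearest_int (x n))"
  proof eventually_elim
    case (elim n)
    have *: "\<bar>real N * x n - of_int (int N * round (x n))\<bar> = real N * dist_nearest_int (x n)"
      by (simp add: dist_nearest_int_def abs_mult flip: right_diff_distrib)
    also have "\<dots> \<le> real N * b" using elim by (intro mult_left_mono) auto
    also have "\<dots> < 1 / 2" by (rule b)
    finally have "\<bar>real N * x n - of_int (int N * round (x n))\<bar> < 1 / 2" using * by simp
    from dist_nearest_int_eqI[OF this] show ?case unfolding * by simp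
  qed
  have "limsup (\<lambda>n. ereal (dist_nearest_int (x_seq (r1 + 2 * r2) \<alpha> h (int n)))) = ereal (real N) * ereal l"
    unfolding xh Limsup_eq[OF ev] lg x_def[symmetric] by (rule Limsup_ereal_mult_left) auto
  thus ?thesis using h unfolding limsup_spectrum_def by (auto intro!: bexI[of _ h])
qed

text \<open>Multiples of a small element \<open>l\<close> form a grid of mesh \<open>l\<close> below \<open>1/2\<close>. The endpoint \<open>1/2\<close>, where the
  previous lemma does not apply, is reached by closing up.\<close>

lemma closure_limsup_spectrum:
  assumes small: "\<And>\<delta>. \<delta> > 0 \<Longrightarrow> \<exists>l\<in>limsup_spectrum k r1 r2 \<alpha>. 0 < l \<and> l < \<delta>"
  shows "closure (limsup_spectrum k r1 r2 \<alpha>) = {0..1/2}"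
proof
  show "closure (limsup_spectrum k r1 r2 \<alpha>) \<subseteq> {0..1/2}"
    by (rule closure_minimal[OF limsup_spectrum_subset]) simp
  have "{0..<1/2} \<subseteq> closure (limsup_spectrum k r1 r2 \<alpha>)"
  proof
    fix t :: real assume t: "t \<in> {0..<1/2}"
    show "t \<in> closure (limsup_spectrum k r1 r2 \<alpha>)"
      unfolding closure_approachable
    proof (intro allI impI)
      fix e :: real assume "e > 0"
      then obtain l where l: "l \<in> limsup_spectrum k r1 r2 \<alpha>" "0 < l" "l < e" using small by blast
      define N where "N = nat \<lfloor>t / l\<rfloor>"
      have N: "real N = of_int \<lfloor>t / l\<rfloor>" using t l(2) by (simp add: N_def)
      have "real N \<le> t / l" "t / l < real N + 1" unfolding N by linarith+
      hence "real N * l \<le> t" "t < real N * l + l" using l(2) by (simp_all add: field_simps)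
      moreover from this have "real N * l \<in> limsup_spectrum k r1 r2 \<alpha>"
        using limsup_spectrum_multiple[OF l(1)] t by simp
      ultimately show "\<exists>y\<in>limsup_spectrum k r1 r2 \<alpha>. dist y t < e"
        using l(3) by (intro bexI[of _ "real N * l"]) (auto simp: dist_real_def)
    qed
  qed
  hence "closure {0..<1/2} \<subseteq> closure (limsup_spectrum k r1 r2 \<alpha>)"
    by (rule closure_minimal) simp
  thus "{0..1/2} \<subseteq> closure (limsup_spectrum k r1 r2 \<alpha>)" by simp
qed

lemma zero_in_limsup_spectrum: "0 \<in> limsup_spectrum k r1 r2 \<alpha>"
proof -
  have "(\<lambda>i. 0) \<in> Xi k r1 r2" by (simp add: Xi_def)
  moreover have "limsup (\<lambda>n::nat. ereal (dist_nearest_int (x_seq (r1 + 2 * r2) \<alpha> (\<lambda>i. 0) (int n)))) = 0"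
    by (simp add: x_seq_def x_complex_def dist_nearest_int_def Limsup_const flip: zero_ereal_def)
  ultimately show ?thesis unfolding limsup_spectrum_def by (auto simp: zero_ereal_def intro!: bexI[of _ "\<lambda>i. 0"])
qed

section \<open>The spectrum near zero\<close>

theorem theorem3:
  fixes P :: "int poly" and k r1 r2 :: nat and \<alpha> :: "nat \<Rightarrow> complex"
  assumes "degree P \<ge> 1" and "lead_coeff P \<ge> 1"
    and "content P = 1" and "coeff P 0 \<noteq> 0"
    and "rsquarefree (cpoly P)"
    and "\<And>Q. irreducible Q \<Longrightarrow> Q dvd P \<Longrightarrow> \<exists>z. poly (cpoly Q) z = 0 \<and> cmod z > 1"
    and "root_ordering P r1 r2 \<alpha>"
    and "lead_coeff P = 1"
  shows "(0 isolated_in limsup_spectrum k r1 r2 \<alpha> \<longleftrightarrow> hyperbolic P) \<and>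
    (\<not> hyperbolic P \<longrightarrow> closure (limsup_spectrum k r1 r2 \<alpha>) = {0..1/2})"
proof -
  define L where "L = (\<Sum>j\<le>degree (cpoly P ^ Suc k). norm (coeff (cpoly P ^ Suc k) j))"
  have "P \<noteq> 0" using assms(8) by auto
  have isolated: "0 isolated_in limsup_spectrum k r1 r2 \<alpha>" if "hyperbolic P"
    unfolding isolated_in_dist_Ex_iff
  proof (intro conjI exI ballI impI)
    show "0 \<in> limsup_spectrum k r1 r2 \<alpha>" by (rule zero_in_limsup_spectrum)
    have "L \<ge> 0" unfolding L_def by (intro sum_nonneg) simp
    thus "1 / (L + 1) > 0" by simp
    fix l assume l: "l \<in> limsup_spectrum k r1 r2 \<alpha>" "dist 0 l < 1 / (L + 1)"
    have "l \<ge> 0" using l(1) limsup_spectrum_subset by fastforce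
    hence "l * L \<le> l * (L + 1)" by (simp add: mult_left_mono)
    also have "\<dots> < 1" using l(2) \<open>l \<ge> 0\<close> \<open>L \<ge> 0\<close> by (simp add: field_simps)
    finally show "l = 0"
      using hyperbolic_small_limsup_eq_0[OF \<open>P \<noteq> 0\<close> that assms(7) l(1)] by (simp add: L_def)
  qed
  have small: "\<exists>l\<in>limsup_spectrum k r1 r2 \<alpha>. 0 < l \<and> l < \<delta>" if "\<not> hyperbolic P" "\<delta> > 0" for \<delta>
    using small_positive_limsup_exists[OF \<open>P \<noteq> 0\<close> assms(5,8,6,7) that] by blast
  have "\<not> 0 isolated_in limsup_spectrum k r1 r2 \<alpha>" if "\<not> hyperbolic P"
  proof
    assume "0 isolated_in limsup_spectrum k r1 r2 \<alpha>"
    then obtain e where "e > 0" "\<forall>y\<in>limsup_spectrum k r1 r2 \<alpha>. dist 0 y < e \<longrightarrow> y = 0"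
      unfolding isolated_in_dist_Ex_iff by blast
    thus False using small[OF that, of e] by auto
  qed
  moreover have "closure (limsup_spectrum k r1 r2 \<alpha>) = {0..1/2}" if "\<not> hyperbolic P"
    by (rule closure_limsup_spectrum) (rule small[OF that])
  ultimately show ?thesis using isolated by blast
qed

end
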